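(* For every odd positive integer $k=2m+1$ with $m\geq 1$, $$\left\lceil \pi m(m+1)-\frac{\pi^2}{4}\right\rceil \leq N(k)\leq \left\lfloor \pi m(m+1)+1\right\rfloor .$$
   Context: The Fermat-Weber point $\mathcal{W}(S)$ of a finite set $S=\{p_1,\dots,p_r\}$ of points in the plane $\mathbb{R}^2$ is the point $p\in\mathbb{R}^2$ minimizing $\sum_{i=1}^r d(p,p_i)$, where $d$ is the Euclidean distance; it is unique when the points of $S$ are not all collinear. For integers $n\ge k\geq 3$, a $k$-chain $C_n(k)$ is the segment of the boundary of a regular $n$-gon formed by $k$ consecutive vertices of the $n$-gon; the $n$-gon may be taken to be inscribed in a unit circle. $\mathcal{W}(C_n(k))$ denotes the Fermat-Weber point of the set of the $k$ vertices of the chain. If $k=2m+1$ is odd and the vertices of the chain in consecutive order are $p_1,\dots,p_{2m+1}$, the root vertex of $C_n(k)$ is the middle vertex $p_{m+1}$. For odd $k=2m+1\ge 3$, $N(k)$ denotes the smallest integer $N\ge k$ such that for all integers $n\ge N$ the point $\mathcal{W}(C_n(k))$ coincides with the root vertex of $C_n(k)$ (such an integer exists); equivalently, $N(k)=\min\{t\in\mathbb{N}: t\ge k,\ 2\sum_{i=1}^m\sin(i\pi/t)-1\le 0\}$. *)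

theory Defs
  imports "HOL-Analysis.Analysis"
begin

definition sum_dist :: "(real^2) set \<Rightarrow> real^2 \<Rightarrow> real" where
  "sum_dist S p = (\<Sum>q\<in>S. dist p q)"

text \<open>For finite nonempty \<open>S\<close> a minimizer exists; it is unique, so that the choice made by
  \<open>arg_min\<close> is irrelevant, whenever the points of \<open>S\<close> are not all collinear.\<close>
definition fermat_weber :: "(real^2) set \<Rightarrow> real^2" where
  "fermat_weber S = arg_min (sum_dist S) (\<lambda>_. True)"

definition ngon_vertex :: "nat \<Rightarrow> nat \<Rightarrow> real^2" where
  "ngon_vertex n j = vector [cos (2 * pi * real j / real n), sin (2 * pi * real j / real n)]"

text \<open>A chain is represented by its vertices, which are all that the Fermat-Weber point of the
  chain depends on.  The definition is meant for \<open>3 \<le> k \<le> n\<close>.\<close>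
definition chain_vertices :: "nat \<Rightarrow> nat \<Rightarrow> (real^2) set" where
  "chain_vertices n k = ngon_vertex n ` {1..k}"

text \<open>For \<open>k = 2 * m + 1\<close> this is the vertex with index \<open>m + 1\<close>.\<close>
definition root_vertex :: "nat \<Rightarrow> nat \<Rightarrow> real^2" where
  "root_vertex n k = ngon_vertex n ((k + 1) div 2)"

definition chain_threshold :: "nat \<Rightarrow> nat" where
  "chain_threshold k =
     (LEAST N. k \<le> N \<and> (\<forall>n\<ge>N. fermat_weber (chain_vertices n k) = root_vertex n k))"

end

theory Submission
  imports Defs
begin

text \<open>
  Both bounds come from an exact criterion for the root vertex to be the Fermat-Weber point.
  The sum of distances to a finite set is convex.  At a point \<open>c\<close> of the set its one-sided
  derivative in direction \<open>w\<close> is the norm of \<open>w\<close>, contributed by \<open>c\<close> itself, plus the inner product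
  of \<open>w\<close> with the sum of the unit vectors pointing from the other points to \<open>c\<close>.  Hence \<open>c\<close> is a
  minimizer exactly when this sum of unit vectors has norm at most 1, and the minimizer is unique
  if the set is not collinear (\<open>fermat_weber_eq_member_iff\<close>).

  A chord of the unit circle from the root to the vertex \<open>i\<close> steps away makes the angle
  \<open>i * pi / n\<close> with the tangent at the root.  The vertices on the two sides of the root are
  mirror images, so tangential components cancel and only the radial ones,
  \<open>sin (i * pi / n)\<close> each, remain.  The criterion becomes
  \<open>2 * (\<Sum>i=1..m. sin (i * pi / n)) \<le> 1\<close> (\<open>fermat_weber_chain_eq_root_iff\<close>).

  Put \<open>A = pi * m * (m + 1)\<close>.  From \<open>sin x \<le> x\<close> the sine sum is at most \<open>A / n\<close>, so the criterion
  holds as soon as \<open>n \<ge> A\<close>.  From \<open>sin x \<ge> x - x ^ 3 / 6\<close> and the formula for sums of cubes, the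
  sine sum at the real argument \<open>t = A - pi\<^sup>2 / 4\<close> is at least
  \<open>A / t - pi * A\<^sup>2 / (12 * t ^ 3)\<close>, which exceeds 1.  The cubic estimate is useless for much smaller
  arguments; these are covered because the sine sum decreases in its argument
  from \<open>2 * m\<close> onwards (\<open>sine_sum_gt_1\<close>).
\<close>

section \<open>Fermat-Weber points lying in the given set\<close>

text \<open>
  The choice operator in \<open>fermat_weber\<close> says nothing without a minimizer.  One exists since,
  for a member \<open>c\<close>, every point farther from \<open>c\<close> than the value at \<open>c\<close> has a larger value,
  which leaves a compact ball.
\<close>
lemma sum_dist_minimizer_exists:
  assumes "finite S" "S \<noteq> {}"
  shows "\<exists>x. \<forall>p. sum_dist S x \<le> sum_dist S p"
proof -
  obtain c where c: "c \<in> S" using assms by auto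
  define R where "R = sum_dist S c"
  have R: "R \<ge> 0" unfolding R_def sum_dist_def by (intro sum_nonneg) auto
  have "continuous_on (cball c R) (sum_dist S)"
    unfolding sum_dist_def by (intro continuous_intros)
  then obtain x where x: "\<And>p. p \<in> cball c R \<Longrightarrow> sum_dist S x \<le> sum_dist S p"
    using continuous_attains_inf[of "cball c R" "sum_dist S"] R by (force simp: R_def)
  have "sum_dist S x \<le> sum_dist S p" for p
  proof (cases "p \<in> cball c R")
    case False
    have "dist p c \<le> sum_dist S p"
      unfolding sum_dist_def using assms c by (intro member_le_sum) auto
    moreover have "sum_dist S x \<le> R" using x[of c] R by (auto simp: R_def)
    ultimately show ?thesis using False by (auto simp: dist_commute)
  qed (use x in auto)
  then show ?thesis by blast
qed

text \<open>
  This is the subgradient inequality at a member \<open>c\<close>: each distance to another point \<open>q\<close> is bounded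
  below by projection to the direction from \<open>q\<close> to \<open>c\<close>, while the term of \<open>c\<close> is kept exact.
  Equality forces equality in every Cauchy-Schwarz step, which puts \<open>p\<close> on the ray from
  \<open>q\<close> through \<open>c\<close>.  The convention \<open>sgn 0 = 0\<close> lets \<open>c\<close> stay in the sum of the unit vectors.
\<close>
lemma sum_dist_ge_member_plus_linear:
  assumes "finite S" "c \<in> S"
  shows "sum_dist S c + norm (p - c) + (p - c) \<bullet> (\<Sum>q\<in>S. sgn (c - q)) \<le> sum_dist S p"
    and "sum_dist S c + norm (p - c) + (p - c) \<bullet> (\<Sum>q\<in>S. sgn (c - q)) = sum_dist S p \<Longrightarrow>
      q \<in> S \<Longrightarrow> norm (p - q) *\<^sub>R (c - q) = norm (c - q) *\<^sub>R (p - q)"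
proof -
  define g where "g = (\<lambda>q. dist c q + (p - c) \<bullet> sgn (c - q))"
  have g: "g q = (p - q) \<bullet> sgn (c - q)" for q
  proof -
    have "dist c q = (c - q) \<bullet> sgn (c - q)"
      by (cases "c = q") (auto simp: sgn_div_norm dist_norm dot_square_norm power2_eq_square)
    then show ?thesis by (simp add: g_def inner_diff_left)
  qed
  have le: "g q \<le> dist p q" for q
  proof -
    have "g q \<le> norm (p - q) * norm (sgn (c - q))" unfolding g by (rule norm_cauchy_schwarz)
    also have "\<dots> \<le> norm (p - q)" by (auto simp: norm_sgn)
    finally show ?thesis by (simp add: dist_norm)
  qed
  have split: "(\<Sum>q\<in>S. f q) = f c + (\<Sum>q\<in>S - {c}. f q)" for f :: "_ \<Rightarrow> real"
    using assms by (simp add: sum.remove)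
  have lhs: "sum_dist S c + norm (p - c) + (p - c) \<bullet> (\<Sum>q\<in>S. sgn (c - q))
      = norm (p - c) + (\<Sum>q\<in>S - {c}. g q)"
    unfolding sum_dist_def inner_sum_right split g_def by (simp add: sum.distrib)
  have rhs: "sum_dist S p = norm (p - c) + (\<Sum>q\<in>S - {c}. dist p q)"
    unfolding sum_dist_def split by (simp add: dist_norm)
  show "sum_dist S c + norm (p - c) + (p - c) \<bullet> (\<Sum>q\<in>S. sgn (c - q)) \<le> sum_dist S p"
    unfolding lhs rhs using le by (intro add_left_mono sum_mono) auto
  assume eq: "sum_dist S c + norm (p - c) + (p - c) \<bullet> (\<Sum>q\<in>S. sgn (c - q)) = sum_dist S p"
    and q: "q \<in> S"
  show "norm (p - q) *\<^sub>R (c - q) = norm (c - q) *\<^sub>R (p - q)"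
  proof (cases "q = c")
    case False
    have "(\<Sum>q\<in>S - {c}. dist p q - g q) = 0"
      using eq unfolding lhs rhs by (simp add: sum_subtractf)
    then have "\<forall>q\<in>S - {c}. dist p q - g q = 0"
      by (subst (asm) sum_nonneg_eq_0_iff) (use assms le in auto)
    then have "(p - q) \<bullet> sgn (c - q) = norm (p - q)"
      using q False by (auto simp: g dist_norm)
    then have "(p - q) \<bullet> (c - q) = norm (p - q) * norm (c - q)"
      using False by (simp add: sgn_div_norm divide_inverse_commute[symmetric] divide_eq_eq)
    then show ?thesis by (subst (asm) norm_cauchy_schwarz_eq)
  qed simp
qed

text \<open>
  If the resultant of the unit vectors were longer than 1, moving from \<open>c\<close> against it would
  decrease the sum: the distance to \<open>c\<close> itself grows at rate \<open>norm w\<close>, while the other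
  distances together shrink at rate \<open>(norm w)\<^sup>2\<close>.
\<close>
lemma member_minimizes_sum_dist_imp:
  assumes "finite S" "c \<in> S" and min: "\<And>p. sum_dist S c \<le> sum_dist S p"
  shows "norm (\<Sum>q\<in>S. sgn (c - q)) \<le> 1"
proof (rule ccontr)
  define w where "w = - (\<Sum>q\<in>S. sgn (c - q))"
  assume "\<not> norm (\<Sum>q\<in>S. sgn (c - q)) \<le> 1"
  then have w: "norm w > 1" by (simp add: w_def)
  \<comment> \<open>For \<open>s \<ge> 0\<close> this is the sum of distances at \<open>c + s *\<^sub>R w\<close>.  Writing \<open>s * norm w\<close> for
    the distance to \<open>c\<close> makes it differentiable at 0.\<close>
  define h where "h = (\<lambda>s. s * norm w + (\<Sum>q\<in>S - {c}. norm (c + s *\<^sub>R w - q)))"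
  have S: "(\<Sum>q\<in>S. sgn (c - q)) = (\<Sum>q\<in>S - {c}. sgn (c - q))"
    using assms by (simp add: sum.remove)
  have deriv: "((\<lambda>s. norm (c + s *\<^sub>R w - q)) has_real_derivative (w \<bullet> sgn (c - q))) (at 0)"
    if "q \<noteq> c" for q
  proof -
    have "((\<lambda>s. c + s *\<^sub>R w - q) has_derivative (\<lambda>s. s *\<^sub>R w)) (at 0)"
      by (auto intro!: derivative_eq_intros)
    moreover have "(norm has_derivative (\<lambda>h. h \<bullet> sgn (c - q))) (at (c + 0 *\<^sub>R w - q))"
      using has_derivative_norm[of "c - q"] that by simp
    ultimately have "((\<lambda>s. norm (c + s *\<^sub>R w - q)) has_derivative (\<lambda>s. (s *\<^sub>R w) \<bullet> sgn (c - q))) (at 0)"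
      by (rule has_derivative_compose)
    then show ?thesis by (simp add: has_field_derivative_def mult.commute[of _ "w \<bullet> _"])
  qed
  have "(h has_real_derivative (norm w + (\<Sum>q\<in>S - {c}. w \<bullet> sgn (c - q)))) (at 0)"
    unfolding h_def by (auto intro!: derivative_eq_intros deriv)
  also have "norm w + (\<Sum>q\<in>S - {c}. w \<bullet> sgn (c - q)) = norm w - (norm w)\<^sup>2"
    by (simp add: inner_sum_right[symmetric] S[symmetric] dot_square_norm[symmetric])
       (simp add: w_def)
  finally have D: "(h has_real_derivative (norm w - (norm w)\<^sup>2)) (at 0)" .
  have "norm w - (norm w)\<^sup>2 < 0" 
    using mult_strict_left_mono[OF w less_trans[OF zero_less_one w]] by (simp add: power2_eq_square)
  then obtain s where s: "s > 0" "h s < h 0"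
    using DERIV_neg_dec_right[OF D] by (metis add_0 field_lbound_gt_zero zero_less_one)
  have "sum_dist S (c + s *\<^sub>R w) = h s" if "s \<ge> 0" for s
    unfolding sum_dist_def h_def using assms that by (simp add: sum.remove dist_norm)
  from this[of s] this[of 0] s min[of "c + s *\<^sub>R w"] show False by simp
qed

text \<open>
  The boundary value 1 does occur for chains (for instance \<open>m = 1\<close> and \<open>n = 6\<close>), where the
  derivative alone gives no strictness.  A second minimizer \<open>p\<close> would be an equality case of
  the subgradient inequality, so all points would lie on the line through \<open>c\<close> and \<open>p\<close>.
\<close>
lemma member_unique_minimizer_sum_dist:
  assumes "finite S" "c \<in> S" "norm (\<Sum>q\<in>S. sgn (c - q)) \<le> 1" "\<not> collinear S" "p \<noteq> c"
  shows "sum_dist S c < sum_dist S p"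
proof (rule ccontr)
  assume not_less: "\<not> sum_dist S c < sum_dist S p"
  note low = sum_dist_ge_member_plus_linear[OF assms(1,2), of p]
  have "- ((p - c) \<bullet> (\<Sum>q\<in>S. sgn (c - q))) \<le> norm (p - c) * norm (\<Sum>q\<in>S. sgn (c - q))"
    using norm_cauchy_schwarz[of "- (p - c)" "\<Sum>q\<in>S. sgn (c - q)"]
    by (simp add: inner_diff_left norm_minus_commute)
  also have "\<dots> \<le> norm (p - c) * 1" by (intro mult_left_mono assms) auto
  finally have eq: "norm (p - q) *\<^sub>R (c - q) = norm (c - q) *\<^sub>R (p - q)" if "q \<in> S" for q
    using low(1) not_less by (intro low(2) that) linarith
  have line: "\<exists>r. q = c + r *\<^sub>R (p - c)" if "q \<in> S" for q
  proof (cases "q = c")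
    case False
    have e: "norm (c - q) *\<^sub>R (p - c) = (norm (p - q) - norm (c - q)) *\<^sub>R (c - q)"
      using eq[OF that] by (simp add: algebra_simps)
    define d where "d = norm (p - q) - norm (c - q)"
    have "d \<noteq> 0" using e False assms(5) by (auto simp: d_def)
    have "c - q = (norm (c - q) / d) *\<^sub>R (p - c)"
      using arg_cong[OF e[folded d_def], of "\<lambda>v. (1 / d) *\<^sub>R v"] \<open>d \<noteq> 0\<close> by simp
    then have "q = c + (- (norm (c - q) / d)) *\<^sub>R (p - c)" by (simp add: algebra_simps)
    then show ?thesis by blast
  next
    case True
    then show ?thesis by (intro exI[of _ 0]) simp
  qed
  have "collinear S"
    unfolding collinear_def
  proof (intro exI[of _ "p - c"] ballI)
    fix x y assume "x \<in> S" "y \<in> S"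
    then obtain r s where "x = c + r *\<^sub>R (p - c)" "y = c + s *\<^sub>R (p - c)" using line by meson
    then have "x - y = (r - s) *\<^sub>R (p - c)" by (simp add: scaleR_diff_left)
    then show "\<exists>t. x - y = t *\<^sub>R (p - c)" by blast
  qed
  with assms show False by simp
qed

lemma fermat_weber_eq_member_iff:
  assumes "finite S" "c \<in> S" "\<not> collinear S"
  shows "fermat_weber S = c \<longleftrightarrow> norm (\<Sum>q\<in>S. sgn (c - q)) \<le> 1"
proof
  assume c: "fermat_weber S = c"
  obtain x where x: "\<forall>p. sum_dist S x \<le> sum_dist S p"
    using sum_dist_minimizer_exists[of S] assms by auto
  have "sum_dist S c \<le> sum_dist S p" for p
    unfolding c[symmetric] fermat_weber_def
    by (rule arg_minI[of "\<lambda>_. True" x]) (use x in \<open>auto simp: not_less\<close>)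
  then show "norm (\<Sum>q\<in>S. sgn (c - q)) \<le> 1"
    using assms by (intro member_minimizes_sum_dist_imp)
next
  assume le: "norm (\<Sum>q\<in>S. sgn (c - q)) \<le> 1"
  note less = member_unique_minimizer_sum_dist[OF assms(1,2) le assms(3)]
  have min: "sum_dist S c \<le> sum_dist S p" for p
    using less[of p] by (cases "p = c") auto
  show "fermat_weber S = c"
    unfolding fermat_weber_def
  proof (rule arg_minI[of "\<lambda>_. True" c])
    fix x assume "\<forall>y. True \<longrightarrow> \<not> sum_dist S y < sum_dist S x"
    then show "x = c" using less by blast
  qed (use min in \<open>auto simp: not_less\<close>)
qed

section \<open>Chains of a regular polygon\<close>

definition circle_point :: "real \<Rightarrow> real^2" where
  "circle_point t = vector [cos t, sin t]"

lemma norm_circle_point [simp]: "norm (circle_point t) = 1"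
  by (simp add: circle_point_def norm_vec_def L2_set_def sum_2)

lemma ngon_vertex_circle_point: "ngon_vertex n j = circle_point (2 * pi * real j / real n)"
  by (simp add: ngon_vertex_def circle_point_def)

lemma norm_ngon_vertex: "norm (ngon_vertex n j) = 1"
  by (simp add: ngon_vertex_circle_point)

lemma circle_point_diff:
  "circle_point a - circle_point b
     = (2 * sin ((b - a) / 2)) *\<^sub>R circle_point ((a + b) / 2 - pi / 2)"
proof -
  have "sin a - sin b = 2 * sin ((b - a) / 2) * (- cos ((a + b) / 2))"
    using sin_minus[of "(a - b) / 2"] by (simp add: sin_diff_sin minus_divide_left)
  then show ?thesis
    by (simp add: circle_point_def vec_eq_iff forall_2 cos_diff_cos sin_diff cos_diff)
qed

text \<open>
  The bound \<open>j < i + n\<close> says that less than one full turn separates the two vertices, so that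
  the chord length \<open>2 * sin (pi * (j - i) / n)\<close> is positive and the chord has the direction of
  \<open>circle_point_diff\<close>.
\<close>
lemma sgn_ngon_vertex_diff:
  assumes "i < j" "j < i + n"
  shows "sgn (ngon_vertex n i - ngon_vertex n j)
    = circle_point (pi * (real i + real j) / real n - pi / 2)"
proof -
  have n: "n > 0" using assms by auto
  define x where "x = pi * (real j - real i) / real n"
  have "0 < x" using assms n by (simp add: x_def)
  moreover have "x < pi"
  proof -
    have "pi * (real j - real i) < pi * real n" using assms by simp
    then show ?thesis using n by (simp add: x_def pos_divide_less_eq)
  qed
  ultimately have "sgn (2 * sin x) = 1" by (simp add: sgn_mult sin_gt_zero)
  moreover have "ngon_vertex n i - ngon_vertex n j
      = (2 * sin x) *\<^sub>R circle_point (pi * (real i + real j) / real n - pi / 2)"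
  proof -
    have "(2 * pi * real j / real n - 2 * pi * real i / real n) / 2 = x"
      and "(2 * pi * real i / real n + 2 * pi * real j / real n) / 2 = pi * (real i + real j) / real n"
      using n by (auto simp: x_def field_simps)
    then show ?thesis unfolding ngon_vertex_circle_point circle_point_diff by simp
  qed
  ultimately show ?thesis by (simp add: sgn_scaleR) (simp add: sgn_div_norm)
qed

lemma ngon_vertex_inj_on:
  assumes "k \<le> n"
  shows "inj_on (ngon_vertex n) {1..k}"
proof (rule linorder_inj_onI')
  fix i j assume "i \<in> {1..k}" "j \<in> {1..k}" "i < j"
  then have "norm (sgn (ngon_vertex n i - ngon_vertex n j)) = 1"
    using assms by (subst sgn_ngon_vertex_diff) auto
  then show "ngon_vertex n i \<noteq> ngon_vertex n j" by auto
qed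

text \<open>
  Of three collinear points one lies between the other two, but balls are strictly convex:
  a point strictly between two unit vectors has norm less than 1.
\<close>
lemma not_collinear_unit_vectors:
  fixes a b c :: "'a::euclidean_space"
  assumes "norm a = 1" "norm b = 1" "norm c = 1" "distinct [a, b, c]"
  shows "\<not> collinear {a, b, c}"
proof
  assume "collinear {a, b, c}"
  moreover have "\<not> between (y, z) x"
    if "norm x = 1" "norm y = 1" "norm z = 1" "x \<noteq> y" "x \<noteq> z" for x y z :: 'a
  proof
    assume "between (y, z) x"
    then have "x \<in> open_segment y z" using that by (auto simp: between_mem_segment open_segment_def)
    from dist_decreases_open_segment[OF this, of 0] show False using that by simp
  qed
  ultimately show False using assms unfolding collinear_between_cases by auto
qed

lemma not_collinear_chain_vertices:
  assumes "3 \<le> k" "k \<le> n"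
  shows "\<not> collinear (chain_vertices n k)"
proof -
  have "ngon_vertex n i \<noteq> ngon_vertex n j" if "i \<in> {1..k}" "j \<in> {1..k}" "i \<noteq> j" for i j
    using inj_onD[OF ngon_vertex_inj_on[OF assms(2)], of i j] that by blast
  from this[of 1 2] this[of 1 3] this[of 2 3]
  have "distinct [ngon_vertex n 1, ngon_vertex n 2, ngon_vertex n 3]" using assms by simp
  then have "\<not> collinear {ngon_vertex n 1, ngon_vertex n 2, ngon_vertex n 3}"
    by (intro not_collinear_unit_vectors norm_ngon_vertex)
  moreover have "{ngon_vertex n 1, ngon_vertex n 2, ngon_vertex n 3} \<subseteq> chain_vertices n k"
    using assms by (auto simp: chain_vertices_def)
  ultimately show ?thesis using collinear_subset by blast
qed

lemma sum_around_middle: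
  fixes f :: "nat \<Rightarrow> 'a::comm_monoid_add"
  shows "(\<Sum>j=1..2 * m + 1. f j) = f (m + 1) + (\<Sum>i=1..m. f (m + 1 - i) + f (m + 1 + i))"
proof -
  have "(\<Sum>j=1..2 * m + 1. f j) = (\<Sum>j=1..m + 1. f j) + (\<Sum>j=m + 2..2 * m + 1. f j)"
    using sum.ub_add_nat[of 1 "m + 1" f m] by (simp add: mult_2)
  also have "(\<Sum>j=1..m + 1. f j) = f (m + 1) + (\<Sum>j=1..m. f j)" by (simp add: add.commute)
  also have "(\<Sum>j=1..m. f j) = (\<Sum>i=1..m. f (m + 1 - i))"
    using sum.atLeastAtMost_rev[of f 1 m] by (simp add: add.commute)
  also have "(\<Sum>j=m + 2..2 * m + 1. f j) = (\<Sum>i=1..m. f (m + 1 + i))"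
    using sum.shift_bounds_cl_nat_ivl[of f 1 "m + 1" m] by (simp add: mult_2 add.commute)
  finally show ?thesis by (simp add: sum.distrib add.assoc)
qed

text \<open>
  The unit vectors belonging to the vertices \<open>i\<close> steps before and after the root are mirror images
  in the radius through the root; their sum is radial with length \<open>2 * sin (i * pi / n)\<close>.
\<close>
lemma sum_sgn_root_vertex:
  assumes "2 * m + 1 \<le> n"
  shows "(\<Sum>q\<in>chain_vertices n (2 * m + 1). sgn (root_vertex n (2 * m + 1) - q))
    = (2 * (\<Sum>i=1..m. sin (real i * pi / real n))) *\<^sub>R root_vertex n (2 * m + 1)"
proof -
  have n: "n > 0" using assms by auto
  define c where "c = ngon_vertex n (m + 1)"
  have root: "root_vertex n (2 * m + 1) = c" by (simp add: root_vertex_def c_def)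
  have pair: "sgn (c - ngon_vertex n (m + 1 - i)) + sgn (c - ngon_vertex n (m + 1 + i))
      = (2 * sin (real i * pi / real n)) *\<^sub>R c" if i: "i \<in> {1..m}" for i
  proof -
    define t where "t = 2 * pi * real (m + 1) / real n"
    define x where "x = real i * pi / real n"
    have "sgn (c - ngon_vertex n (m + 1 + i)) = circle_point (t + x - pi / 2)"
    proof -
      have "pi * (real (m + 1) + real (m + 1 + i)) / real n = t + x"
        using n by (simp add: t_def x_def field_simps)
      then show ?thesis
        unfolding c_def using i assms by (subst sgn_ngon_vertex_diff) auto
    qed
    moreover have "sgn (ngon_vertex n (m + 1 - i) - c) = circle_point (t - x - pi / 2)"
    proof -
      have "real (m + 1 - i) = real (m + 1) - real i" using i by (simp add: of_nat_diff)
      then have "pi * (real (m + 1 - i) + real (m + 1)) / real n = t - x"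
        using n by (simp add: t_def x_def field_simps)
      then show ?thesis
        unfolding c_def using i assms by (subst sgn_ngon_vertex_diff) auto
    qed
    then have "sgn (c - ngon_vertex n (m + 1 - i)) = - circle_point (t - x - pi / 2)"
      by (metis minus_diff_eq sgn_minus)
    moreover have "c = circle_point t" by (simp add: c_def t_def ngon_vertex_circle_point)
    moreover have "- circle_point (t - x - pi / 2) + circle_point (t + x - pi / 2)
        = (2 * sin x) *\<^sub>R circle_point t"
      by (simp add: circle_point_def vec_eq_iff forall_2 sin_diff cos_diff sin_add cos_add)
    ultimately show ?thesis by (simp add: x_def)
  qed
  have "(\<Sum>q\<in>chain_vertices n (2 * m + 1). sgn (c - q))
      = (\<Sum>j=1..2 * m + 1. sgn (c - ngon_vertex n j))"
    unfolding chain_vertices_def using assms by (subst sum.reindex[OF ngon_vertex_inj_on]) auto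
  also have "\<dots> = (\<Sum>i=1..m. sgn (c - ngon_vertex n (m + 1 - i)) + sgn (c - ngon_vertex n (m + 1 + i)))"
    unfolding sum_around_middle by (simp add: c_def)
  also have "\<dots> = (\<Sum>i=1..m. (2 * sin (real i * pi / real n)) *\<^sub>R c)"
    by (intro sum.cong pair refl)
  also have "\<dots> = (2 * (\<Sum>i=1..m. sin (real i * pi / real n))) *\<^sub>R c"
    by (simp only: sum_distrib_left scaleR_sum_left)
  finally show ?thesis unfolding root .
qed

lemma fermat_weber_chain_eq_root_iff:
  assumes "m \<ge> 1" "2 * m + 1 \<le> n"
  shows "fermat_weber (chain_vertices n (2 * m + 1)) = root_vertex n (2 * m + 1)
    \<longleftrightarrow> 2 * (\<Sum>i=1..m. sin (real i * pi / real n)) \<le> 1"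
proof -
  have "(\<Sum>i=1..m. sin (real i * pi / real n)) \<ge> 0"
  proof (intro sum_nonneg sin_ge_zero)
    fix i assume "i \<in> {1..m}"
    then have "real i * pi \<le> real n * pi" using assms by (intro mult_right_mono) auto
    then show "real i * pi / real n \<le> pi" using assms by (simp add: field_simps)
  qed auto
  moreover have finite: "finite (chain_vertices n (2 * m + 1))"
    and root: "root_vertex n (2 * m + 1) \<in> chain_vertices n (2 * m + 1)"
    by (auto simp: chain_vertices_def root_vertex_def)
  moreover have "norm (root_vertex n (2 * m + 1)) = 1"
    by (simp add: root_vertex_def norm_ngon_vertex)
  ultimately show ?thesis
    using fermat_weber_eq_member_iff[OF finite root not_collinear_chain_vertices] assms
    unfolding sum_sgn_root_vertex[OF assms(2)] by simp
qed

section \<open>Estimates of the sine sum\<close>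

lemma sum_of_cubes: "(\<Sum>i=1..m. real i ^ 3) = (real m * (real m + 1) / 2)\<^sup>2"
  by (induction m) (auto simp: power2_eq_square power3_eq_cube field_simps)

lemma sum_of_indices: "2 * (\<Sum>i=1..m. real i) = real m * (real m + 1)"
  by (induction m) (auto simp: algebra_simps)

lemma sine_sum_upper:
  assumes "t > 0"
  shows "2 * (\<Sum>i=1..m. sin (real i * pi / t)) \<le> pi * real m * (real m + 1) / t"
proof -
  have "(\<Sum>i=1..m. sin (real i * pi / t)) \<le> (\<Sum>i=1..m. real i * pi / t)"
    using assms by (intro sum_mono sin_x_le_x) auto
  also have "\<dots> = (\<Sum>i=1..m. real i) * (pi / t)"
    unfolding sum_distrib_right by (intro sum.cong) auto
  finally have "2 * (\<Sum>i=1..m. sin (real i * pi / t)) \<le> 2 * (\<Sum>i=1..m. real i) * (pi / t)"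
    by simp
  then show ?thesis unfolding sum_of_indices by (simp add: mult_ac)
qed

lemma sin_ge_cubic:
  fixes x :: real
  assumes "0 \<le> x"
  shows "x - x ^ 3 / 6 \<le> sin x"
proof -
  have "sin 0 - (0 - 0 ^ 3 / 6) \<le> sin x - (x - x ^ 3 / 6)"
  proof (rule DERIV_nonneg_imp_nondecreasing[OF assms])
    fix y :: real
    have "((\<lambda>y. sin y - (y - y ^ 3 / 6)) has_real_derivative (cos y - (1 - y\<^sup>2 / 2))) (at y)"
      by (auto intro!: derivative_eq_intros)
    moreover have "cos y - (1 - y\<^sup>2 / 2) \<ge> 0"
    proof -
      have "(sin (y / 2))\<^sup>2 \<le> (y / 2)\<^sup>2"
        using abs_sin_x_le_abs_x[of "y / 2"] by (simp only: abs_le_square_iff)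
      then show ?thesis using cos_double_sin[of "y / 2"] by (simp add: power_divide)
    qed
    ultimately show "\<exists>z. ((\<lambda>y. sin y - (y - y ^ 3 / 6)) has_real_derivative z) (at y) \<and> z \<ge> 0"
      by blast
  qed
  then show ?thesis by simp
qed

lemma sine_sum_lower:
  fixes t :: real and m :: nat
  assumes "t > 0"
  defines "A \<equiv> pi * real m * (real m + 1)"
  shows "A / t - pi * A\<^sup>2 / (12 * t ^ 3) \<le> 2 * (\<Sum>i=1..m. sin (real i * pi / t))"
proof -
  have "(\<Sum>i=1..m. real i * (pi / t) - real i ^ 3 * ((pi / t) ^ 3 / 6))
      \<le> (\<Sum>i=1..m. sin (real i * pi / t))"
  proof (rule sum_mono)
    fix i
    show "real i * (pi / t) - real i ^ 3 * ((pi / t) ^ 3 / 6) \<le> sin (real i * pi / t)"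
      using sin_ge_cubic[of "real i * pi / t"] assms by (simp add: power_divide power_mult_distrib)
  qed
  moreover have "2 * (\<Sum>i=1..m. real i * (pi / t) - real i ^ 3 * ((pi / t) ^ 3 / 6))
      = (2 * (\<Sum>i=1..m. real i)) * (pi / t) - 2 * ((\<Sum>i=1..m. real i ^ 3) * ((pi / t) ^ 3 / 6))"
    by (simp only: sum_subtractf right_diff_distrib mult.assoc flip: sum_distrib_right)
  moreover have "\<dots> = A / t - pi * A\<^sup>2 / (12 * t ^ 3)"
    unfolding sum_of_indices sum_of_cubes A_def using assms
    by (simp add: field_simps power2_eq_square power3_eq_cube)
  ultimately show ?thesis by linarith
qed

text \<open>
  The bound \<open>2 * real m \<le> s\<close> keeps all angles within the first quadrant, where the sine increases.
\<close>
lemma sine_sum_antimono: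
  assumes "2 * real m \<le> s" "s \<le> t" "0 < s"
  shows "(\<Sum>i=1..m. sin (real i * pi / t)) \<le> (\<Sum>i=1..m. sin (real i * pi / s))"
proof (intro sum_mono sin_monotone_2pi_le)
  fix i assume i: "i \<in> {1..m}"
  show "real i * pi / t \<le> real i * pi / s" using assms by (intro divide_left_mono) auto
  have "2 * real i \<le> s" using i assms by (auto intro: order_trans[rotated])
  then have "pi * (2 * real i) \<le> pi * s" by (intro mult_left_mono) auto
  then show "real i * pi / s \<le> pi / 2" using assms by (simp add: field_simps)
  have "0 \<le> real i * pi / t" using assms by auto
  then show "- (pi / 2) \<le> real i * pi / t" using pi_gt_zero by linarith
qed

text \<open>
  By monotonicity it is enough to look at the right end \<open>t = A - pi\<^sup>2 / 4\<close> of the range.  There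
  \<open>A / t = 1 + pi\<^sup>2 / 4 / t\<close>, so the cubic error \<open>pi * A\<^sup>2 / (12 * t ^ 3)\<close> has to be less than
  \<open>pi\<^sup>2 / 4 / t\<close>, that is, \<open>A\<^sup>2 < 3 * pi * t\<^sup>2\<close>.
\<close>
lemma sine_sum_gt_1:
  assumes "m \<ge> 1"
    and "2 * real m \<le> s" "s < pi * real m * (real m + 1) - pi\<^sup>2 / 4"
  shows "2 * (\<Sum>i=1..m. sin (real i * pi / s)) > 1"
proof -
  define A where "A = pi * real m * (real m + 1)"
  define t where "t = A - pi\<^sup>2 / 4"
  have s: "0 < s" "s \<le> t" "0 < t" using assms by (auto simp: t_def A_def)
  have "1 * 2 \<le> real m * (real m + 1)" using assms(1) by (intro mult_mono) auto
  then have "pi * 2 \<le> A" by (simp add: A_def mult.assoc)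
  \<comment> \<open>The factor 3/5 is a convenient one above \<open>1 / sqrt (3 * pi)\<close>; the tightest case is
    \<open>m = 1\<close>, where \<open>A = 2 * pi\<close> and the claim reads \<open>pi \<le> 16/5\<close>.\<close>
  moreover have "pi * pi \<le> pi * (16/5)" using pi_approx by (intro mult_left_mono) auto
  ultimately have "3/5 * A \<le> t"
    unfolding t_def power2_eq_square by linarith
  then have "(3/5 * A)\<^sup>2 \<le> t\<^sup>2" using order_trans[OF _ \<open>pi * 2 \<le> A\<close>, of 0] by (intro power_mono) auto
  then have "A\<^sup>2 \<le> 25/9 * t\<^sup>2" by (simp add: power2_eq_square)
  also have "\<dots> < 3 * pi * t\<^sup>2" using s pi_gt3 by (intro mult_strict_right_mono) auto
  finally have "pi * A\<^sup>2 < pi * (3 * pi * t\<^sup>2)" by (rule mult_strict_left_mono) simp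
  then have "pi * A\<^sup>2 / (12 * t ^ 3) < (pi * (3 * pi * t\<^sup>2)) / (12 * t ^ 3)"
    using s by (intro divide_strict_right_mono) auto
  also have "\<dots> = pi\<^sup>2 / 4 / t" using s by (simp add: field_simps power2_eq_square power3_eq_cube)
  finally have "1 < A / t - pi * A\<^sup>2 / (12 * t ^ 3)"
    using s by (simp add: t_def diff_divide_distrib[symmetric] field_simps)
  also have "\<dots> \<le> 2 * (\<Sum>i=1..m. sin (real i * pi / t))"
    using sine_sum_lower[of t m] s by (simp add: A_def)
  also have "\<dots> \<le> 2 * (\<Sum>i=1..m. sin (real i * pi / s))"
    using sine_sum_antimono[of m s t] assms s by simp
  finally show ?thesis .
qed

section \<open>Bounds of the threshold\<close>

theorem theorem2:
  fixes k m :: nat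
  assumes "k = 2 * m + 1" and "m \<ge> 1"
  shows "\<lceil>pi * real m * (real m + 1) - pi\<^sup>2 / 4\<rceil> \<le> int (chain_threshold k)
    \<and> int (chain_threshold k) \<le> \<lfloor>pi * real m * (real m + 1) + 1\<rfloor>"
proof -
  define A where "A = pi * real m * (real m + 1)"
  define P where "P = (\<lambda>N. k \<le> N \<and> (\<forall>n\<ge>N. fermat_weber (chain_vertices n k) = root_vertex n k))"
  define N where "N = nat \<lfloor>A + 1\<rfloor>"
  have "3 * (real m * 2) \<le> pi * (real m * (real m + 1))"
    using assms pi_gt3 by (intro mult_mono) auto
  then have A: "6 * real m \<le> A" by (simp add: A_def mult.assoc)
  then have N: "int N = \<lfloor>A + 1\<rfloor>" using assms by (simp add: N_def)
  then have "A \<le> real N" by linarith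
  then have "k \<le> N" using A assms by linarith
  \<comment> \<open>Having a witness bounds the threshold above and also ensures that the least element in the
    definition of the threshold has the defining property.\<close>
  have "P N"
    unfolding P_def
  proof (intro conjI allI impI \<open>k \<le> N\<close>)
    fix n assume n: "N \<le> n"
    then have "n > 0" "A \<le> real n" using \<open>A \<le> real N\<close> \<open>k \<le> N\<close> assms by auto
    then have "2 * (\<Sum>i=1..m. sin (real i * pi / real n)) \<le> 1"
      using order_trans[OF sine_sum_upper[of "real n" m]] by (simp add: A_def)
    then show "fermat_weber (chain_vertices n k) = root_vertex n k"
      using fermat_weber_chain_eq_root_iff[of m n] n \<open>k \<le> N\<close> assms by simp
  qed
  have threshold: "chain_threshold k = (LEAST N. P N)" by (simp add: chain_threshold_def P_def)
  have "chain_threshold k \<le> N" unfolding threshold by (rule Least_le) fact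
  moreover have "P (chain_threshold k)" unfolding threshold by (rule LeastI) fact
  then have k: "k \<le> chain_threshold k"
    and "2 * (\<Sum>i=1..m. sin (real i * pi / real (chain_threshold k))) \<le> 1"
    using fermat_weber_chain_eq_root_iff[of m "chain_threshold k"] assms by (auto simp: P_def)
  then have "A - pi\<^sup>2 / 4 \<le> real (chain_threshold k)"
    using sine_sum_gt_1[of m "real (chain_threshold k)"] assms
    by (force simp: A_def not_less[symmetric])
  then have "\<lceil>A - pi\<^sup>2 / 4\<rceil> \<le> int (chain_threshold k)" by (simp add: ceiling_le_iff)
  ultimately show ?thesis using N by (simp add: A_def)
qed

end
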